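(* There exist an integer $n\ge 2$ and integers $1=j_1<j_2<\dots<j_n=N$, together with an index $I\in\{1,\dots,n-1\}$ with $j_I=J$ and $j_{I+1}=K$, such that $$\Gamma=\{\gamma_{JK}\}\cup\{\tilde\gamma_{j_i j_{i+1}}: i=1,\dots,n-1,\ i\neq I\}.$$
   Context: Setting. Fix an integer $N\ge 2$ and real parameters $x_1<\dots<x_N$, $\beta_j>0$ ($1\le j\le N$). Newton polygon. Let $P=\{(2(x_k-x_j),\,\beta_j+\beta_k):1\le j<k\le N\}\cup\{(0,0)\}\subset\mathbb{R}^2$, with points written $(\lambda,\nu)$. The Newton polygon is the convex hull of the epigraph $\{(\lambda,t):(\lambda,\nu)\in P,\ t\ge\nu\}$. $\Gamma$ is the (finite) set of slopes of the non-vertical edges of the boundary of this Newton polygon. Standing assumption. The non-infinite slopes of the Newton polygon are unique, in the sense that among any three distinct collinear points of $P$ at least one lies in the interior of the Newton polygon. Notation. For $1\le j<k\le N$ put $\gamma_{jk}=\dfrac{\beta_k+\beta_j}{2(x_k-x_j)}$ and $\tilde\gamma_{jk}=\dfrac{|\beta_k-\beta_j|}{2(x_k-x_j)}$. The dominant pair $(J,K)$, $J<K$, is the pair minimizing $\gamma_{jk}$ among all pairs $j<k$; the standing assumption guarantees that it is unique. *)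

theory Defs
  imports "HOL-Analysis.Analysis"
begin

text \<open>
  The parameters \<open>x\<^sub>1, \<dots>, x\<^sub>N\<close> and \<open>\<beta>\<^sub>1, \<dots>, \<beta>\<^sub>N\<close> are functions \<open>nat \<Rightarrow> real\<close>, of which only
  the values at the indices \<open>1, \<dots>, N\<close> matter.
  Points \<open>(\<lambda>, \<nu>)\<close> of the plane are elements of \<open>real \<times> real\<close>.
\<close>

definition index_pairs :: "nat \<Rightarrow> (nat \<times> nat) set" where
  "index_pairs N = {(j, k). 1 \<le> j \<and> j < k \<and> k \<le> N}"

definition exponent_points ::
    "nat \<Rightarrow> (nat \<Rightarrow> real) \<Rightarrow> (nat \<Rightarrow> real) \<Rightarrow> (real \<times> real) set" where
  "exponent_points N x \<beta> =
     {(2 * (x k - x j), \<beta> j + \<beta> k) | j k. (j, k) \<in> index_pairs N} \<union> {(0, 0)}"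

definition newton_polygon :: "(real \<times> real) set \<Rightarrow> (real \<times> real) set" where
  "newton_polygon P = convex hull {(l, t) | l t. \<exists>\<nu>. (l, \<nu>) \<in> P \<and> \<nu> \<le> t}"

text \<open>
  Edges are one-dimensional faces, which includes the two unbounded vertical ones. An edge is
  non-vertical iff it contains two points with different first coordinates, and any two such points
  determine its slope.
\<close>
definition newton_slopes :: "(real \<times> real) set \<Rightarrow> real set" where
  "newton_slopes P =
     {(snd q - snd p) / (fst q - fst p) | e p q.
        e edge_of newton_polygon P \<and> p \<in> e \<and> q \<in> e \<and> fst p \<noteq> fst q}"

definition unique_slopes :: "(real \<times> real) set \<Rightarrow> bool" where
  "unique_slopes P \<longleftrightarrow>
     (\<forall>p\<in>P. \<forall>q\<in>P. \<forall>r\<in>P. p \<noteq> q \<and> p \<noteq> r \<and> q \<noteq> r \<and> collinear {p, q, r} \<longrightarrow>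
        (\<exists>v\<in>{p, q, r}. v \<in> interior (newton_polygon P)))"

definition gam :: "(nat \<Rightarrow> real) \<Rightarrow> (nat \<Rightarrow> real) \<Rightarrow> nat \<Rightarrow> nat \<Rightarrow> real" where
  "gam x \<beta> j k = (\<beta> k + \<beta> j) / (2 * (x k - x j))"

definition gam_tilde :: "(nat \<Rightarrow> real) \<Rightarrow> (nat \<Rightarrow> real) \<Rightarrow> nat \<Rightarrow> nat \<Rightarrow> real" where
  "gam_tilde x \<beta> j k = \<bar>\<beta> k - \<beta> j\<bar> / (2 * (x k - x j))"

text \<open>
  A minimizer always exists, because there are finitely many pairs and at least one if \<open>N \<ge> 2\<close>.
  Uniqueness is not part of the definition: it follows from \<open>unique_slopes\<close> for strictly
  increasing \<open>x\<close> and positive \<open>\<beta>\<close>.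
\<close>
definition dominant_pair ::
    "nat \<Rightarrow> (nat \<Rightarrow> real) \<Rightarrow> (nat \<Rightarrow> real) \<Rightarrow> nat \<Rightarrow> nat \<Rightarrow> bool" where
  "dominant_pair N x \<beta> J K \<longleftrightarrow>
     is_arg_min (\<lambda>(j, k). gam x \<beta> j k) (\<lambda>p. p \<in> index_pairs N) (J, K)"

end

theory Submission
  imports Defs
begin

text \<open>
  The slopes of the lower boundary of a convex region are the kinks of its support function: a slope
  \<open>s\<close> belongs to an edge iff the tilted height \<open>\<nu> - s \<lambda>\<close> is minimal at two points of \<open>P\<close> with different
  abscissas (lemma \<open>newton_slopes_eq_kinks\<close>). This replaces the geometry of the polygon by a
  one-parameter family of minimization problems.

  The tilted height of the point of the pair \<open>(j, k)\<close> is the sum of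
  \<open>\<beta>\<^sub>j + 2 s x\<^sub>j\<close> and \<open>\<beta>\<^sub>k - 2 s x\<^sub>k\<close>, so the two indices could be chosen independently if it were not for
  the condition \<open>j < k\<close> and for the extra point at the origin. Both obstacles disappear once \<open>s\<close> passes
  \<open>\<gamma> = \<gamma>\<^sub>J\<^sub>K\<close>. For \<open>s < \<gamma>\<close> every pair has positive height, so that the origin is the only minimizer.
  For \<open>s > \<gamma>\<close> the dominant pair has negative height, which eliminates the origin; moreover a sum that
  is not positive forces \<open>x\<^sub>j < x\<^sub>k\<close>, because \<open>\<beta>\<^sub>j + \<beta>\<^sub>k > 0\<close>. Hence the unconstrained minimizers of the two summands
  automatically form an admissible pair. The slopes are therefore \<open>\<gamma>\<close> and the kinks beyond \<open>\<gamma>\<close>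
  of the lower envelopes of the two families of lines \<open>\<beta>\<^sub>j + 2 s x\<^sub>j\<close> and \<open>\<beta>\<^sub>k - 2 s x\<^sub>k\<close> (lemma \<open>slopes_eq\<close>).

  Along the envelope of a family of lines the active index changes monotonically, and each kink is the
  slope between two consecutive active indices (lemma \<open>kinks_chain\<close>). As \<open>s\<close> grows from \<open>\<gamma>\<close>, the right index
  climbs from \<open>K\<close> to \<open>N\<close> and the left index descends from \<open>J\<close> to \<open>1\<close>. The reversed left chain followed by the
  right chain is the required sequence. The standing assumption enters only at \<open>s = \<gamma>\<close>, where it
  guarantees that both chains start at the dominant pair: a second minimizer would produce three points of
  \<open>P\<close> on the boundary line through the origin (lemma \<open>ends_at_\<gamma>\<close>).
\<close>

section \<open>Slopes as kinks of the support function\<close>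

text \<open>
  The indices whose points \<open>(u i, v i)\<close> touch the supporting line of slope \<open>s\<close> from above. The points are
  given by a parametrization so that the same notion serves for \<open>P\<close> itself, with \<open>fst\<close> and \<open>snd\<close>, and for the
  two families of lines in which its points decompose.
\<close>
definition lowest :: "real \<Rightarrow> ('a \<Rightarrow> real) \<Rightarrow> ('a \<Rightarrow> real) \<Rightarrow> 'a set \<Rightarrow> 'a set" where
  "lowest s u v S = {i \<in> S. \<forall>k\<in>S. v i - s * u i \<le> v k - s * u k}"

text \<open>
  For finite \<open>S\<close>, the minimum of \<open>v i - s * u i\<close> is a concave, piecewise linear function of \<open>s\<close> with
  slopes \<open>- u i\<close>, so it fails to be differentiable exactly at these values of \<open>s\<close>.
\<close>
definition kinks :: "('a \<Rightarrow> real) \<Rightarrow> ('a \<Rightarrow> real) \<Rightarrow> 'a set \<Rightarrow> real set" where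
  "kinks u v S = {s. \<exists>i\<in>lowest s u v S. \<exists>k\<in>lowest s u v S. u i \<noteq> u k}"

lemma kinkI:
  "i \<in> lowest s u v S \<Longrightarrow> k \<in> lowest s u v S \<Longrightarrow> u i \<noteq> u k \<Longrightarrow> s \<in> kinks u v S"
  unfolding kinks_def by blast

lemma newton_polygon_lower_bound:
  assumes "\<And>r. r \<in> P \<Longrightarrow> m \<le> snd r - s * fst r" and "z \<in> newton_polygon P"
  shows "m \<le> snd z - s * fst z"
proof -
  have "convex {z. inner (- s, 1) z \<ge> m}"
    by (rule convex_halfspace_ge)
  moreover have "{(l, t) | l t. \<exists>\<nu>. (l, \<nu>) \<in> P \<and> \<nu> \<le> t} \<subseteq> {z. inner (- s, 1) z \<ge> m}"
    using assms(1) by (force simp: inner_prod_def)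
  ultimately have "newton_polygon P \<subseteq> {z. inner (- s, 1) z \<ge> m}"
    unfolding newton_polygon_def by (intro hull_minimal)
  then show ?thesis
    using assms(2) by (auto simp: inner_prod_def)
qed

lemma points_subset_newton_polygon: "P \<subseteq> newton_polygon P"
  unfolding newton_polygon_def by (intro subset_trans[OF _ hull_subset]) auto

lemma newton_polygon_upward:
  assumes "z \<in> newton_polygon P" and "0 \<le> t"
  shows "z + (0, t) \<in> newton_polygon P"
proof -
  let ?E = "{(l, t) | l t. \<exists>\<nu>. (l, \<nu>) \<in> P \<and> \<nu> \<le> t}"
  have "(+) (0, t) ` ?E \<subseteq> ?E"
    using assms(2) by force
  then have "convex hull ((+) (0, t) ` ?E) \<subseteq> convex hull ?E"
    by (rule hull_mono)
  then show ?thesis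
    using assms(1) unfolding newton_polygon_def convex_hull_translation by (force simp: add.commute)
qed

text \<open>
  The linear functional \<open>\<nu> - s \<lambda>\<close> is bounded below on the polygon by its value at the minimizer, but it is not
  constant on any neighbourhood. This is how the standing assumption is put to use.
\<close>
lemma lowest_not_in_interior:
  assumes "p \<in> lowest s fst snd P"
  shows "p \<notin> interior (newton_polygon P)"
proof
  assume "p \<in> interior (newton_polygon P)"
  moreover have "newton_polygon P \<subseteq> {z. inner (- s, 1) z \<ge> snd p - s * fst p}"
    using assms newton_polygon_lower_bound[of P "snd p - s * fst p" s]
    by (auto simp: lowest_def inner_prod_def)
  ultimately have "p \<in> interior {z. inner (- s, 1) z \<ge> snd p - s * fst p}"
    using interior_mono by blast
  moreover have "(- s, 1 :: real) \<noteq> 0"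
    by (simp add: zero_prod_def)
  ultimately have "p \<in> {z. inner (- s, 1) z > snd p - s * fst p}"
    using interior_halfspace_ge[of "(- s, 1 :: real)"] by blast
  then show False
    by (simp add: inner_prod_def)
qed

text \<open>
  Since the polygon is closed under moving upwards, a point strictly below the line of a
  non-vertical edge would sit on a vertical segment that crosses this line in its interior. By the
  face property the edge would contain that whole segment, although it lies on the line. So the line supports the
  polygon. It remains to see that it carries points of \<open>P\<close> with two different abscissas; otherwise the polygon
  would meet the line in a single point.
\<close>
lemma kink_if_newton_slope:
  assumes "e edge_of newton_polygon P" and p: "p \<in> e" and q: "q \<in> e" and pq: "fst p \<noteq> fst q"
  shows "(snd q - snd p) / (fst q - fst p) \<in> kinks fst snd P"
proof -
  let ?C = "newton_polygon P"
  define s where "s = (snd q - snd p) / (fst q - fst p)"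
  define f :: "real \<times> real \<Rightarrow> real" where "f z = snd z - s * fst z" for z
  define m where "m = f p"
  have face: "e face_of ?C" and dim: "aff_dim e = 1"
    using assms(1) by (auto simp: edge_of_def)
  have C: "convex ?C"
    by (simp add: newton_polygon_def)
  have fq: "f q = m"
    using pq by (simp add: m_def f_def s_def field_simps)
  have line: "affine hull e = {z. f z = m}"
  proof -
    have L: "{z. f z = m} = {z. inner (- s, 1) z = m}"
      by (auto simp: f_def inner_prod_def)
    have aff: "affine {z. f z = m}"
      unfolding L by (rule affine_hyperplane)
    have "aff_dim {z. f z = m} = 1"
      unfolding L by (subst aff_dim_hyperplane) (auto simp: zero_prod_def)
    moreover have "aff_dim {p, q} = 1"
      using pq by (auto simp: aff_dim_2)
    moreover have "{p, q} \<subseteq> {z. f z = m}" "{p, q} \<subseteq> e"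
      using p q fq m_def by auto
    ultimately have "affine hull e = affine hull {z. f z = m}"
      using aff_dim_eq_full_gen dim by metis
    then show ?thesis
      using aff by (simp add: hull_same)
  qed
  have e: "e = ?C \<inter> {z. f z = m}"
    using face_of_imp_eq_affine_Int[OF C face] line by auto
  have below: "m \<le> f r" if r: "r \<in> ?C" for r
  proof (rule ccontr)
    assume "\<not> m \<le> f r"
    then have t: "0 < m - f r" by simp
    \<comment> \<open>The midpoint of \<open>r\<close> and \<open>?top\<close> lies on the line.\<close>
    let ?mid = "r + (0, m - f r)" and ?top = "r + (0, 2 * (m - f r))"
    have "?mid \<in> ?C" "?top \<in> ?C"
      using newton_polygon_upward[OF r] t by auto
    moreover have "f ?mid = m"
      by (simp add: f_def)
    moreover have "?mid \<in> open_segment r ?top"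
    proof -
      have "?mid = (1 - 1/2) *\<^sub>R r + (1/2) *\<^sub>R ?top"
        by (simp add: prod_eq_iff field_simps)
      moreover have "r \<noteq> ?top"
        using t by (auto simp: prod_eq_iff)
      ultimately show ?thesis
        unfolding in_segment by (intro conjI exI[of _ "1/2"]) auto
    qed
    ultimately have "r \<in> e"
      using face r e unfolding face_of_def by blast
    then show False
      using t e by auto
  qed
  have "\<exists>a\<in>P. \<exists>b\<in>P. f a = m \<and> f b = m \<and> fst a \<noteq> fst b"
  proof (rule ccontr)
    assume "\<not> ?thesis"
    then obtain c where c: "\<And>a. a \<in> P \<Longrightarrow> f a = m \<Longrightarrow> fst a = c"
      by metis
    \<comment> \<open>Convex, contains the generators of the polygon, and meets the line in at most one point.\<close>
    define D where "D = {z. f z > m \<or> f z = m \<and> fst z = c}"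
    have "convex D"
      unfolding convex_alt
    proof (intro ballI allI impI)
      fix y z :: "real \<times> real" and u :: real
      assume y: "y \<in> D" and z: "z \<in> D" and u: "0 \<le> u \<and> u \<le> 1"
      have lin: "f ((1 - u) *\<^sub>R y + u *\<^sub>R z) - m = (1 - u) * (f y - m) + u * (f z - m)"
        by (simp add: f_def algebra_simps)
      have nn: "0 \<le> (1 - u) * (f y - m)" "0 \<le> u * (f z - m)"
        using y z u by (auto simp: D_def)
      consider "u = 0" | "u = 1" | "0 < u" "u < 1" "f y > m \<or> f z > m"
        | "f y = m" "f z = m" "fst y = c" "fst z = c"
        using u y z unfolding D_def by fastforce
      then show "(1 - u) *\<^sub>R y + u *\<^sub>R z \<in> D"
      proof cases
        case 3
        then have "0 < (1 - u) * (f y - m) + u * (f z - m)"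
          using nn by (metis add_nonneg_pos add_pos_nonneg diff_gt_0_iff_gt mult_pos_pos)
        then show ?thesis
          using lin by (simp add: D_def)
      next
        case 4
        then show ?thesis
          using lin by (simp add: D_def algebra_simps)
      qed (use y z in auto)
    qed
    moreover have "{(l, t) | l t. \<exists>\<nu>. (l, \<nu>) \<in> P \<and> \<nu> \<le> t} \<subseteq> D"
    proof clarify
      fix l t \<nu>
      assume P: "(l, \<nu>) \<in> P" and \<nu>: "\<nu> \<le> t"
      have "m \<le> f (l, \<nu>)"
        using below P points_subset_newton_polygon by blast
      then show "(l, t) \<in> D"
        using c[OF P] \<nu> by (auto simp: D_def f_def)
    qed
    ultimately have "?C \<subseteq> D"
      unfolding newton_polygon_def by (intro hull_minimal)
    then have "fst p = c" "fst q = c"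
      using p q e by (auto simp: D_def)
    then show False
      using pq by simp
  qed
  then obtain a b where ab: "a \<in> P" "b \<in> P" "f a = m" "f b = m" "fst a \<noteq> fst b"
    by blast
  have "m \<le> f r" if "r \<in> P" for r
    using below that points_subset_newton_polygon by blast
  then have "a \<in> lowest s fst snd P" "b \<in> lowest s fst snd P"
    using ab by (simp_all add: lowest_def f_def)
  then have "s \<in> kinks fst snd P"
    using ab(5) by (rule kinkI)
  then show ?thesis
    by (simp add: s_def)
qed

lemma newton_slope_if_kink:
  assumes "s \<in> kinks fst snd P"
  shows "s \<in> newton_slopes P"
proof -
  let ?C = "newton_polygon P"
  obtain p q where p: "p \<in> lowest s fst snd P" and q: "q \<in> lowest s fst snd P"
    and pq: "fst p \<noteq> fst q"
    using assms by (auto simp: kinks_def)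
  define m where "m = snd p - s * fst p"
  define e where "e = ?C \<inter> {z. inner (- s, 1) z = m}"
  have fq: "snd q - s * fst q = m"
    using p q unfolding lowest_def m_def by (auto intro: antisym)
  have "e face_of ?C"
    unfolding e_def
  proof (rule face_of_Int_supporting_hyperplane_ge)
    show "convex ?C"
      by (simp add: newton_polygon_def)
    show "m \<le> inner (- s, 1) z" if "z \<in> ?C" for z
      using newton_polygon_lower_bound[OF _ that, of m s] p
      by (auto simp: m_def lowest_def inner_prod_def)
  qed
  moreover have in_e: "p \<in> e" "q \<in> e"
    using p q fq points_subset_newton_polygon
    by (auto simp: e_def m_def lowest_def inner_prod_def)
  moreover have "aff_dim e = 1"
  proof (rule antisym)
    have "aff_dim e \<le> aff_dim {z :: real \<times> real. inner (- s, 1) z = m}"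
      by (intro aff_dim_subset) (auto simp: e_def)
    also have "\<dots> = 1"
      by (subst aff_dim_hyperplane) (auto simp: zero_prod_def)
    finally show "aff_dim e \<le> 1" .
    have "aff_dim {p, q} = 1"
      using pq by (auto simp: aff_dim_2)
    then show "1 \<le> aff_dim e"
      using aff_dim_subset[of "{p, q}" e] in_e by auto
  qed
  ultimately have "e edge_of ?C"
    by (simp add: edge_of_def)
  moreover have "s = (snd q - snd p) / (fst q - fst p)"
    using pq fq by (simp add: m_def field_simps)
  ultimately show ?thesis
    using in_e pq unfolding newton_slopes_def by blast
qed

lemma newton_slopes_eq_kinks: "newton_slopes P = kinks fst snd P"
  using kink_if_newton_slope newton_slope_if_kink by (fastforce simp: newton_slopes_def)

section \<open>The lower envelope of finitely many lines\<close>

text \<open>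
  Monotonicity of the minimizers in the parameter: the two optimality inequalities add up to
  \<open>0 \<le> (t - s) * (u k - u i)\<close>.
\<close>
lemma lowest_mono:
  assumes "i \<in> lowest s u v S" and "k \<in> lowest t u v S" and "s < t"
  shows "u i \<le> u k"
proof -
  have "v i - s * u i \<le> v k - s * u k" "v k - t * u k \<le> v i - t * u i"
    using assms by (auto simp: lowest_def)
  then have "0 \<le> (t - s) * (u k - u i)"
    by (simp add: algebra_simps)
  then show ?thesis
    using assms(3) by (simp add: zero_le_mult_iff)
qed

lemma lowest_nonempty:
  assumes "finite S" and "S \<noteq> {}"
  shows "lowest s u v S \<noteq> {}"
proof -
  obtain i where "is_arg_min (\<lambda>i. v i - s * u i) (\<lambda>i. i \<in> S) i"
    using ex_is_arg_min_if_finite[OF assms] by blast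
  then show ?thesis
    by (auto simp: lowest_def is_arg_min_linorder)
qed

text \<open>
  The list collects the indices that become active one after the other when \<open>t\<close> grows beyond \<open>s\<close>, as in gift
  wrapping. Starting at \<open>K\<close>, the next kink is the smallest slope \<open>\<sigma>\<close> from \<open>K\<close> to an index with larger \<open>u\<close>,
  and the next active index is the one with the largest \<open>u\<close> among those tied there. Between two
  consecutive kinks monotonicity leaves only indices with the same \<open>u\<close>, so no kink is overlooked.

  The induction is possible because \<open>K\<close> need not be the only minimizer at \<open>s\<close>, just one with the largest \<open>u\<close>: at
  each kink there are ties, and the next stage starts exactly there.
\<close>
lemma kinks_chain:
  assumes "finite S" and "K \<in> lowest s u v S" and "\<And>k. k \<in> lowest s u v S \<Longrightarrow> u k \<le> u K"
  shows "\<exists>ks. ks \<noteq> [] \<and> set ks \<subseteq> S \<and> hd ks = K \<and> (\<forall>k\<in>S. u k \<le> u (last ks)) \<and>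
           sorted_wrt (\<lambda>a b. u a < u b) ks \<and>
           kinks u v S \<inter> {s<..} = (\<lambda>(a, b). (v b - v a) / (u b - u a)) ` set (zip ks (tl ks))"
  using assms(2,3)
proof (induction "card {i \<in> S. u K < u i}" arbitrary: K s rule: less_induct)
  case less
  note K = less.prems(1) and K_max = less.prems(2)
  let ?T = "{i \<in> S. u K < u i}"
  have fin: "finite ?T"
    using assms(1) by simp
  have KS: "K \<in> S"
    using K by (simp add: lowest_def)
  show ?case
  proof (cases "?T = {}")
    case True
    have "u i = u K" if "s < t" "i \<in> lowest t u v S" for t i
      using lowest_mono[OF K that(2,1)] True that(2) by (force simp: lowest_def)
    then have "kinks u v S \<inter> {s<..} = {}"
      by (auto simp: kinks_def)
    then show ?thesis
      using True KS by (intro exI[of _ "[K]"]) (auto simp: not_less)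
  next
    case False
    define \<sigma> where "\<sigma> i = (v i - v K) / (u i - u K)" for i
    define t where "t = Min (\<sigma> ` ?T)"
    have "t \<in> \<sigma> ` ?T"
      using fin False unfolding t_def by (intro Min_in) auto
    then obtain i where i: "i \<in> S" "u K < u i" "\<sigma> i = t"
      by auto
    have t_le: "t \<le> \<sigma> k" if "k \<in> ?T" for k
      using fin that unfolding t_def by (intro Min_le) auto
    have "v K - s * u K < v i - s * u i"
    proof (rule ccontr)
      assume "\<not> ?thesis"
      then have "i \<in> lowest s u v S"
        using K i(1) unfolding lowest_def by force
      then show False
        using K_max i(2) by force
    qed
    then have st: "s < t"
      using i(2) unfolding i(3)[symmetric] \<sigma>_def by (simp add: field_simps)
    have K_t: "K \<in> lowest t u v S"
      unfolding lowest_def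
    proof (intro CollectI conjI ballI KS)
      fix k assume k: "k \<in> S"
      show "v K - t * u K \<le> v k - t * u k"
      proof (cases "u K < u k")
        case True
        then show ?thesis
          using t_le[of k] k by (simp add: \<sigma>_def field_simps)
      next
        case False
        then have "0 \<le> (t - s) * (u K - u k)"
          using st by simp
        moreover have "v K - s * u K \<le> v k - s * u k"
          using K k by (simp add: lowest_def)
        ultimately show ?thesis
          by (simp add: algebra_simps)
      qed
    qed
    have "v i - t * u i = v K - t * u K"
      using i(2) unfolding i(3)[symmetric] \<sigma>_def by (simp add: field_simps)
    then have i_t: "i \<in> lowest t u v S"
      using K_t i(1) by (simp add: lowest_def)
    have "finite (lowest t u v S)"
      using assms(1) by (simp add: lowest_def)
    then have "\<exists>K'. is_arg_min (\<lambda>k. - u k) (\<lambda>k. k \<in> lowest t u v S) K'"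
      using i_t by (intro ex_is_arg_min_if_finite) auto
    then obtain K' where K': "K' \<in> lowest t u v S" "\<And>k. k \<in> lowest t u v S \<Longrightarrow> u k \<le> u K'"
      by (auto simp: is_arg_min_linorder)
    have KK': "u K < u K'"
      using K'(2)[OF i_t] i(2) by simp
    have "{i \<in> S. u K' < u i} \<subset> ?T"
      using KK' K'(1) by (auto simp: lowest_def)
    then have "card {i \<in> S. u K' < u i} < card ?T"
      by (rule psubset_card_mono[OF fin])
    from less.hyps[OF this K'] obtain ks where ks: "ks \<noteq> []" "set ks \<subseteq> S" "hd ks = K'"
      "\<forall>k\<in>S. u k \<le> u (last ks)" "sorted_wrt (\<lambda>a b. u a < u b) ks"
      "kinks u v S \<inter> {t<..} = (\<lambda>(a, b). (v b - v a) / (u b - u a)) ` set (zip ks (tl ks))"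
      by auto
    have "r = t" if "s < r" "r \<le> t" "r \<in> kinks u v S" for r
    proof (rule ccontr)
      assume "r \<noteq> t"
      then have "u k = u K" if "k \<in> lowest r u v S" for k
        using lowest_mono[OF K that] lowest_mono[OF that K_t] \<open>s < r\<close> \<open>r \<le> t\<close> by simp
      then show False
        using that(3) by (auto simp: kinks_def)
    qed
    moreover have "t \<in> kinks u v S"
      using K_t K'(1) KK' by (force simp: kinks_def)
    ultimately have "kinks u v S \<inter> {s<..} = insert t (kinks u v S \<inter> {t<..})"
      using st by force
    moreover have "t = (v K' - v K) / (u K' - u K)"
    proof -
      have "v K' - t * u K' = v K - t * u K"
        using K_t K'(1) by (auto simp: lowest_def intro: antisym)
      then show ?thesis
        using KK' by (simp add: field_simps)
    qed
    moreover have "zip (K # ks) (tl (K # ks)) = (K, K') # zip ks (tl ks)"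
      using ks(1,3) by (cases ks) auto
    moreover have "sorted_wrt (\<lambda>a b. u a < u b) (K # ks)"
      using ks(1,3,5) KK' by (cases ks) auto
    ultimately show ?thesis
      using ks KS by (intro exI[of _ "K # ks"]) auto
  qed
qed

section \<open>Decoupling the two indices of a pair\<close>

locale newton_data =
  fixes N J K :: nat and x \<beta> :: "nat \<Rightarrow> real"
  assumes x_mono: "strict_mono_on {1..N} x"
    and \<beta>_pos: "\<And>j. j \<in> {1..N} \<Longrightarrow> \<beta> j > 0"
    and unique: "unique_slopes (exponent_points N x \<beta>)"
    and dominant: "dominant_pair N x \<beta> J K"
begin

abbreviation "P \<equiv> exponent_points N x \<beta>"
abbreviation "\<gamma> \<equiv> gam x \<beta> J K"
text \<open>
  The minimizers of the two summands of \<open>height s j k\<close>, each over all indices: the condition \<open>j < k\<close> is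
  deliberately dropped. The sign in \<open>left_end\<close> turns its lines into the same form \<open>v i - s * u i\<close>.
\<close>
abbreviation "right_end s \<equiv> lowest s (\<lambda>k. 2 * x k) \<beta> {1..N}"
abbreviation "left_end s \<equiv> lowest s (\<lambda>j. - 2 * x j) \<beta> {1..N}"
abbreviation "point j k \<equiv> (2 * (x k - x j), \<beta> j + \<beta> k)"
abbreviation "height s j k \<equiv> (\<beta> j + 2 * s * x j) + (\<beta> k - 2 * s * x k)"

lemma x_less_iff: "j \<in> {1..N} \<Longrightarrow> k \<in> {1..N} \<Longrightarrow> x j < x k \<longleftrightarrow> j < k"
  using x_mono by (rule strict_mono_on_less)

lemma x_eq_iff: "j \<in> {1..N} \<Longrightarrow> k \<in> {1..N} \<Longrightarrow> x j = x k \<longleftrightarrow> j = k"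
  using x_mono by (rule strict_mono_on_eq)

lemma JK: "J \<in> {1..N}" "K \<in> {1..N}" "J < K"
  using dominant by (auto simp: dominant_pair_def is_arg_min_def index_pairs_def)

lemma gam_min: "j \<in> {1..N} \<Longrightarrow> k \<in> {1..N} \<Longrightarrow> j < k \<Longrightarrow> \<gamma> \<le> gam x \<beta> j k"
  using dominant by (auto simp: dominant_pair_def is_arg_min_linorder index_pairs_def)

lemma less_gam_iff:
  assumes "j \<in> {1..N}" "k \<in> {1..N}" "j < k"
  shows "s < gam x \<beta> j k \<longleftrightarrow> 0 < height s j k" and "s \<le> gam x \<beta> j k \<longleftrightarrow> 0 \<le> height s j k"
  using assms x_less_iff[of j k] by (auto simp: gam_def field_simps)

lemma \<gamma>_pos: "0 < \<gamma>"
  using JK \<beta>_pos[of J] \<beta>_pos[of K] x_less_iff[of J K] by (simp add: gam_def)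

lemma in_P_iff: "p \<in> P \<longleftrightarrow> p = (0, 0) \<or> (\<exists>j\<in>{1..N}. \<exists>k\<in>{1..N}. j < k \<and> p = point j k)"
  by (auto simp: exponent_points_def index_pairs_def) force+

text \<open>
  For \<open>j \<ge> k\<close> both \<open>\<beta> j + \<beta> k\<close> and \<open>2 * s * (x j - x k)\<close> would push the height above zero. This is why dropping the
  condition \<open>j < k\<close> does not change the minimum once that minimum is not positive.
\<close>
lemma less_if_height_nonpos:
  assumes "j \<in> {1..N}" "k \<in> {1..N}" "0 \<le> s" "height s j k \<le> 0"
  shows "j < k"
proof (rule ccontr)
  assume "\<not> j < k"
  then have "x k \<le> x j"
    using x_less_iff[of j k] assms(1,2) by simp
  then have "0 \<le> 2 * s * (x j - x k)"
    using assms(3) by simp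
  moreover have "0 < \<beta> j" "0 < \<beta> k"
    using \<beta>_pos assms(1,2) by auto
  ultimately show False
    using assms(4) by (simp add: algebra_simps)
qed

lemma left_end_iff:
  "j \<in> left_end s \<longleftrightarrow> j \<in> {1..N} \<and> (\<forall>i\<in>{1..N}. \<beta> j + 2 * s * x j \<le> \<beta> i + 2 * s * x i)"
  by (simp add: lowest_def algebra_simps)

lemma right_end_iff:
  "k \<in> right_end s \<longleftrightarrow> k \<in> {1..N} \<and> (\<forall>i\<in>{1..N}. \<beta> k - 2 * s * x k \<le> \<beta> i - 2 * s * x i)"
  by (simp add: lowest_def algebra_simps)

lemma ends_le_height:
  assumes "j \<in> left_end s" "k \<in> right_end s" "j' \<in> {1..N}" "k' \<in> {1..N}"
  shows "height s j k \<le> height s j' k'"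
  using assms unfolding left_end_iff right_end_iff by (blast intro: add_mono)

text \<open>
  A sum of two independent quantities is minimal only if each of them is.
\<close>
lemma ends_if_height_le:
  assumes "j \<in> left_end s" "k \<in> right_end s" "j' \<in> {1..N}" "k' \<in> {1..N}"
    and "height s j' k' \<le> height s j k"
  shows "j' \<in> left_end s" and "k' \<in> right_end s"
proof -
  have "\<beta> j + 2 * s * x j \<le> \<beta> i + 2 * s * x i" "\<beta> k - 2 * s * x k \<le> \<beta> i - 2 * s * x i"
    if "i \<in> {1..N}" for i
    using assms(1,2) that unfolding left_end_iff right_end_iff by blast+
  note min = this
  have eq: "\<beta> j' + 2 * s * x j' = \<beta> j + 2 * s * x j" "\<beta> k' - 2 * s * x k' = \<beta> k - 2 * s * x k"
    using min(1)[OF assms(3)] min(2)[OF assms(4)] assms(5) by linarith+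
  show "j' \<in> left_end s"
    using min(1) assms(3) unfolding left_end_iff eq(1) by blast
  show "k' \<in> right_end s"
    using min(2) assms(4) unfolding right_end_iff eq(2) by blast
qed

text \<open>
  From \<open>\<gamma>\<close> on, the dominant pair witnesses that the unconstrained minimum is not positive, so that the
  unconstrained minimizers are ordered correctly.
\<close>
lemma ends_height_JK:
  assumes "\<gamma> \<le> s" "j \<in> left_end s" "k \<in> right_end s"
  shows "height s j k \<le> height s J K" and "height s J K \<le> 0" and "j < k"
    and "j \<in> {1..N}" and "k \<in> {1..N}"
proof -
  show N: "j \<in> {1..N}" "k \<in> {1..N}"
    using assms(2,3) by (auto simp: lowest_def)
  show 1: "height s j k \<le> height s J K"
    using ends_le_height[OF assms(2,3) JK(1,2)] .
  show 2: "height s J K \<le> 0"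
    using less_gam_iff(1)[OF JK, of s] assms(1) by simp
  show "j < k"
    using less_if_height_nonpos[OF N, of s] 1 2 assms(1) \<gamma>_pos by simp
qed

lemma ends_nonempty: "left_end s \<noteq> {}" "right_end s \<noteq> {}"
  using JK(1) by (intro lowest_nonempty; force)+

lemma point_lowest_at_ends:
  assumes "\<gamma> \<le> s" "j \<in> left_end s" "k \<in> right_end s"
  shows "point j k \<in> lowest s fst snd P"
proof -
  note * = ends_height_JK[OF assms]
  have "height s j k \<le> snd r - s * fst r" if "r \<in> P" for r
    using that ends_le_height[OF assms(2,3)] *(1,2) unfolding in_P_iff
    by (force simp: algebra_simps)
  moreover have "point j k \<in> P"
    using *(3-5) unfolding in_P_iff by blast
  ultimately show ?thesis
    by (auto simp: lowest_def algebra_simps)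
qed

lemma lowest_above_\<gamma>:
  assumes "\<gamma> < s" "p \<in> lowest s fst snd P"
  obtains j k where "j \<in> left_end s" "k \<in> right_end s" "p = point j k"
proof -
  obtain j0 k0 where 0: "j0 \<in> left_end s" "k0 \<in> right_end s"
    using ends_nonempty by blast
  have "\<gamma> \<le> s" using assms(1) by simp
  note * = ends_height_JK[OF this 0]
  have "point j0 k0 \<in> P"
    using *(3-5) unfolding in_P_iff by blast
  then have le: "snd p - s * fst p \<le> height s j0 k0"
    using assms(2) by (force simp: lowest_def algebra_simps)
  have neg: "height s J K < 0"
    using less_gam_iff(2)[OF JK, of s] assms(1) by simp
  have "p \<in> P"
    using assms(2) by (simp add: lowest_def)
  moreover have "p \<noteq> (0, 0)"
    using le neg *(1) by auto
  ultimately obtain j k where jk: "j \<in> {1..N}" "k \<in> {1..N}" "p = point j k"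
    unfolding in_P_iff by blast
  have le': "height s j k \<le> height s j0 k0"
    using le jk(3) by (simp add: algebra_simps)
  show ?thesis
    using that[OF ends_if_height_le[OF 0 jk(1,2) le'] jk(3)] .
qed

lemma origin_lowest_at_\<gamma>: "(0, 0) \<in> lowest \<gamma> fst snd P"
proof -
  have "0 \<le> snd r - \<gamma> * fst r" if "r \<in> P" for r
  proof (cases "r = (0, 0)")
    case False
    then obtain j k where jk: "j \<in> {1..N}" "k \<in> {1..N}" "j < k" "r = point j k"
      using \<open>r \<in> P\<close> unfolding in_P_iff by blast
    then have "0 \<le> height \<gamma> j k"
      using gam_min less_gam_iff(2) by blast
    then show ?thesis
      using jk(4) by (simp add: algebra_simps)
  qed simp
  then show ?thesis
    by (simp add: lowest_def in_P_iff)
qed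

text \<open>
  At \<open>s = \<gamma>\<close> the minimal height is zero, attained at the origin and at the dominant pair. If one of the two index
  choices had a second solution, exchanging just that index would give two pairs with different abscissas,
  hence three distinct points of \<open>P\<close> on the line of slope \<open>\<gamma>\<close> through the origin. None of them is an
  interior point, contrary to the standing assumption. Varying the indices one at a time matters, because
  different pairs may well have the same point.
\<close>
lemma ends_at_\<gamma>: "left_end \<gamma> = {J}" "right_end \<gamma> = {K}"
proof -
  have zero: "height \<gamma> J K = 0"
    using less_gam_iff[OF JK, of \<gamma>] by simp
  have tie: "height \<gamma> j k = 0" if "j \<in> left_end \<gamma>" "k \<in> right_end \<gamma>" for j k
    using ends_height_JK[OF order_refl that] gam_min[of j k] less_gam_iff(2)[of j k \<gamma>] by simp
  obtain j0 k0 where 0: "j0 \<in> left_end \<gamma>" "k0 \<in> right_end \<gamma>"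
    using ends_nonempty by blast
  have J: "J \<in> left_end \<gamma>" and K: "K \<in> right_end \<gamma>"
    using ends_if_height_le[OF 0 JK(1,2)] tie[OF 0] zero by simp_all
  have same: "fst (point j k) = fst (point j' k')"
    if "j \<in> left_end \<gamma>" "k \<in> right_end \<gamma>" "j' \<in> left_end \<gamma>" "k' \<in> right_end \<gamma>" for j k j' k'
  proof (rule ccontr)
    assume ne: "fst (point j k) \<noteq> fst (point j' k')"
    have low: "point j k \<in> lowest \<gamma> fst snd P" "point j' k' \<in> lowest \<gamma> fst snd P"
      using point_lowest_at_ends that by auto
    have pos: "x j < x k" "x j' < x k'"
      using ends_height_JK(3-5)[OF order_refl that(1,2)] ends_height_JK(3-5)[OF order_refl that(3,4)]
        x_less_iff by auto
    \<comment> \<open>Height zero means that the point lies on the line of slope \<open>\<gamma>\<close> through the origin.\<close>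
    have eq: "point i l = fst (point i l) *\<^sub>R (1, \<gamma>)" if "i \<in> left_end \<gamma>" "l \<in> right_end \<gamma>" for i l
      using tie[OF that] by (simp add: algebra_simps)
    have "collinear {0, a *\<^sub>R w, b *\<^sub>R w}" if "a \<noteq> 0" for a b :: real and w :: "real \<times> real"
      unfolding collinear_lemma using that by (intro disjI2 exI[of _ "b / a"]) simp
    from this[of "fst (point j k)" "(1, \<gamma>)" "fst (point j' k')"]
    have "collinear {0, point j k, point j' k'}"
      unfolding eq[OF that(1,2), symmetric] eq[OF that(3,4), symmetric] using pos(1) by simp
    then have "collinear {(0, 0), point j k, point j' k'}"
      by (simp only: zero_prod_def)
    moreover have "(0, 0) \<noteq> point j k" "(0, 0) \<noteq> point j' k'" "point j k \<noteq> point j' k'"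
      using pos ne by auto
    moreover have "(0, 0) \<in> P" "point j k \<in> P" "point j' k' \<in> P"
      using low origin_lowest_at_\<gamma> unfolding lowest_def by blast+
    ultimately obtain w where "w \<in> {(0, 0), point j k, point j' k'}" "w \<in> interior (newton_polygon P)"
      using unique unfolding unique_slopes_def by meson
    then show False
      using lowest_not_in_interior low origin_lowest_at_\<gamma> by blast
  qed
  have "j = J" if "j \<in> left_end \<gamma>" for j
    using same[OF that K J K] x_eq_iff[of j J] that JK by (simp add: lowest_def)
  then show "left_end \<gamma> = {J}"
    using J by blast
  have "k = K" if "k \<in> right_end \<gamma>" for k
    using same[OF J that J K] x_eq_iff[of k K] that JK by (simp add: lowest_def)
  then show "right_end \<gamma> = {K}"
    using K by blast
qed

lemma slopes_eq:
  "newton_slopes P = insert \<gamma> (kinks (\<lambda>j. - 2 * x j) \<beta> {1..N} \<inter> {\<gamma><..} \<union>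
                                kinks (\<lambda>k. 2 * x k) \<beta> {1..N} \<inter> {\<gamma><..})"
proof -
  have below: "s \<notin> kinks fst snd P" if "s < \<gamma>" for s
  proof -
    have "p = (0, 0)" if p: "p \<in> lowest s fst snd P" for p
    proof (rule ccontr)
      assume "p \<noteq> (0, 0)"
      then obtain j k where jk: "j \<in> {1..N}" "k \<in> {1..N}" "j < k" "p = point j k"
        using p unfolding lowest_def in_P_iff by blast
      have "snd p - s * fst p \<le> 0"
        using p in_P_iff[of "(0, 0)"] unfolding lowest_def by force
      then have "height s j k \<le> 0"
        using jk(4) by (simp add: algebra_simps)
      then show False
        using gam_min[OF jk(1-3)] less_gam_iff(1)[OF jk(1-3), of s] \<open>s < \<gamma>\<close> by simp
    qed
    then show ?thesis
      unfolding kinks_def by blast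
  qed
  have at: "\<gamma> \<in> kinks fst snd P"
  proof -
    have "point J K \<in> lowest \<gamma> fst snd P"
      using point_lowest_at_ends[of \<gamma> J K] ends_at_\<gamma> by simp
    moreover note origin_lowest_at_\<gamma>
    moreover have "fst (point J K) \<noteq> fst (0, 0 :: real)"
      using JK x_less_iff[of J K] by simp
    ultimately show ?thesis
      by (rule kinkI)
  qed
  have above: "s \<in> kinks fst snd P \<longleftrightarrow>
      s \<in> kinks (\<lambda>j. - 2 * x j) \<beta> {1..N} \<or> s \<in> kinks (\<lambda>k. 2 * x k) \<beta> {1..N}"
    if "\<gamma> < s" for s
  proof
    assume "s \<in> kinks fst snd P"
    then obtain p q where p: "p \<in> lowest s fst snd P" and q: "q \<in> lowest s fst snd P"
      and ne: "fst p \<noteq> fst q"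
      by (auto simp: kinks_def)
    obtain j k where 1: "j \<in> left_end s" "k \<in> right_end s" "p = point j k"
      using lowest_above_\<gamma>[OF \<open>\<gamma> < s\<close> p] .
    obtain j' k' where 2: "j' \<in> left_end s" "k' \<in> right_end s" "q = point j' k'"
      using lowest_above_\<gamma>[OF \<open>\<gamma> < s\<close> q] .
    have "x j \<noteq> x j' \<or> x k \<noteq> x k'"
      using ne 1(3) 2(3) by auto
    then show "s \<in> kinks (\<lambda>j. - 2 * x j) \<beta> {1..N} \<or> s \<in> kinks (\<lambda>k. 2 * x k) \<beta> {1..N}"
      using kinkI[OF 1(1) 2(1)] kinkI[OF 1(2) 2(2)] by auto
  next
    have low: "point j k \<in> lowest s fst snd P" if "j \<in> left_end s" "k \<in> right_end s" for j k
      using point_lowest_at_ends[OF _ that] \<open>\<gamma> < s\<close> by simp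
    obtain j0 k0 where 0: "j0 \<in> left_end s" "k0 \<in> right_end s"
      using ends_nonempty by blast
    assume "s \<in> kinks (\<lambda>j. - 2 * x j) \<beta> {1..N} \<or> s \<in> kinks (\<lambda>k. 2 * x k) \<beta> {1..N}"
    then consider j j' where "j \<in> left_end s" "j' \<in> left_end s" "x j \<noteq> x j'"
      | k k' where "k \<in> right_end s" "k' \<in> right_end s" "x k \<noteq> x k'"
      unfolding kinks_def by auto
    then show "s \<in> kinks fst snd P"
    proof cases
      case 1
      then show ?thesis
        using kinkI[OF low[OF 1(1) 0(2)] low[OF 1(2) 0(2)]] by simp
    next
      case 2
      then show ?thesis
        using kinkI[OF low[OF 0(1) 2(1)] low[OF 0(1) 2(2)]] by simp
    qed
  qed
  show ?thesis
    unfolding newton_slopes_eq_kinks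
  proof (intro set_eqI)
    fix s
    show "s \<in> kinks fst snd P \<longleftrightarrow> s \<in> insert \<gamma> (kinks (\<lambda>j. - 2 * x j) \<beta> {1..N} \<inter> {\<gamma><..} \<union>
                                kinks (\<lambda>k. 2 * x k) \<beta> {1..N} \<inter> {\<gamma><..})"
      using below[of s] at above[of s] by (cases s \<gamma> rule: linorder_cases) auto
  qed
qed

end

section \<open>Consecutive entries of a list\<close>

lemma set_zip_tl: "set (zip xs (tl xs)) = {(xs ! i, xs ! Suc i) | i. Suc i < length xs}"
  by (auto simp: set_zip nth_tl less_diff_conv)

text \<open>
  The excluded index is the seam between the two lists. The indices are shifted so that \<open>i\<close> numbers the entries from
  one, as in a sequence \<open>j\<^sub>1, \<dots>, j\<^sub>n\<close>.
\<close>
lemma set_zip_tl_append: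
  assumes "xs \<noteq> []" "ys \<noteq> []"
  shows "{((xs @ ys) ! (i - 1), (xs @ ys) ! i) | i. i \<in> {1..length (xs @ ys) - 1} \<and> i \<noteq> length xs}
    = set (zip xs (tl xs)) \<union> set (zip ys (tl ys))" (is "?L = ?R")
proof
  show "?L \<subseteq> ?R"
  proof clarify
    fix i
    assume i: "i \<in> {1..length (xs @ ys) - 1}" "i \<noteq> length xs"
      and no: "((xs @ ys) ! (i - 1), (xs @ ys) ! i) \<notin> set (zip ys (tl ys))"
    show "((xs @ ys) ! (i - 1), (xs @ ys) ! i) \<in> set (zip xs (tl xs))"
    proof (cases "i < length xs")
      case True
      then show ?thesis
        using i unfolding set_zip_tl by (auto simp: nth_append intro!: exI[of _ "i - 1"])
    next
      case False
      then have "((xs @ ys) ! (i - 1), (xs @ ys) ! i) \<in> set (zip ys (tl ys))"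
        using i unfolding set_zip_tl
        by (auto simp: nth_append Suc_diff_Suc intro!: exI[of _ "i - 1 - length xs"])
      then show ?thesis
        using no by simp
    qed
  qed
  show "?R \<subseteq> ?L"
  proof (intro Un_least subsetI)
    fix z assume "z \<in> set (zip xs (tl xs))"
    then obtain i where "Suc i < length xs" "z = (xs ! i, xs ! Suc i)"
      unfolding set_zip_tl by blast
    then show "z \<in> ?L"
      by (auto simp: nth_append intro!: exI[of _ "Suc i"])
  next
    fix z assume "z \<in> set (zip ys (tl ys))"
    then obtain i where "Suc i < length ys" "z = (ys ! i, ys ! Suc i)"
      unfolding set_zip_tl by blast
    then show "z \<in> ?L"
      using assms by (auto simp: nth_append intro!: exI[of _ "length xs + Suc i"])
  qed
qed

lemma set_zip_tl_rev: "set (zip (rev xs) (tl (rev xs))) = prod.swap ` set (zip xs (tl xs))"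
proof (induction xs)
  case (Cons a xs)
  show ?case
  proof (cases xs)
    case xs: (Cons b ys)
    have "zip (zs @ [b, a]) (tl (zs @ [b, a])) = zip (zs @ [b]) (tl (zs @ [b])) @ [(b, a)]" for zs
    proof (induction zs)
      case (Cons c zs)
      then show ?case
        by (cases zs) auto
    qed simp
    from this[of "rev ys"]
    have "zip (rev (a # xs)) (tl (rev (a # xs))) = zip (rev xs) (tl (rev xs)) @ [(b, a)]"
      by (simp add: xs)
    moreover have "zip (a # xs) (tl (a # xs)) = (a, b) # zip xs (tl xs)"
      unfolding xs by simp
    ultimately show ?thesis
      using Cons.IH by simp
  qed simp
qed simp

section \<open>The slopes of the Newton polygon\<close>

theorem theorem2:
  fixes N J K :: nat and x \<beta> :: "nat \<Rightarrow> real"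
  assumes "N \<ge> 2"
    and "strict_mono_on {1..N} x"
    and "\<forall>j\<in>{1..N}. \<beta> j > 0"
    and "unique_slopes (exponent_points N x \<beta>)"
    and "dominant_pair N x \<beta> J K"
  shows "\<exists>(n::nat) (j :: nat \<Rightarrow> nat) (I::nat).
           n \<ge> 2 \<and> j 1 = 1 \<and> j n = N \<and> strict_mono_on {1..n} j \<and>
           I \<in> {1..n - 1} \<and> j I = J \<and> j (I + 1) = K \<and>
           newton_slopes (exponent_points N x \<beta>) =
             {gam x \<beta> J K} \<union>
             {gam_tilde x \<beta> (j i) (j (i + 1)) | i. i \<in> {1..n - 1} \<and> i \<noteq> I}"
proof -
  interpret newton_data N J K x \<beta>
    using assms by unfold_locales auto
  obtain js where js: "js \<noteq> []" "set js \<subseteq> {1..N}" "hd js = J"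
    "\<forall>k\<in>{1..N}. - 2 * x k \<le> - 2 * x (last js)" "sorted_wrt (\<lambda>a b. - 2 * x a < - 2 * x b) js"
    and js_kinks: "kinks (\<lambda>j. - 2 * x j) \<beta> {1..N} \<inter> {\<gamma><..} =
       (\<lambda>(a, b). (\<beta> b - \<beta> a) / (- 2 * x b - - 2 * x a)) ` set (zip js (tl js))"
    using kinks_chain[of "{1..N}" J \<gamma> "\<lambda>j. - 2 * x j" \<beta>] ends_at_\<gamma> by auto
  obtain ks where ks: "ks \<noteq> []" "set ks \<subseteq> {1..N}" "hd ks = K"
    "\<forall>k\<in>{1..N}. 2 * x k \<le> 2 * x (last ks)" "sorted_wrt (\<lambda>a b. 2 * x a < 2 * x b) ks"
    and ks_kinks: "kinks (\<lambda>k. 2 * x k) \<beta> {1..N} \<inter> {\<gamma><..} =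
       (\<lambda>(a, b). (\<beta> b - \<beta> a) / (2 * x b - 2 * x a)) ` set (zip ks (tl ks))"
    using kinks_chain[of "{1..N}" K \<gamma> "\<lambda>k. 2 * x k" \<beta>] ends_at_\<gamma> by auto
  have less: "a < b" if "x a < x b" "a \<in> {1..N}" "b \<in> {1..N}" for a b
    using x_less_iff that by blast
  have ks_sorted: "sorted_wrt (<) ks"
    using ks(5) by (rule sorted_wrt_mono_rel[rotated]) (use less ks(2) in force)
  have js_sorted: "sorted_wrt (<) (rev js)"
    unfolding sorted_wrt_rev
    using js(5) by (rule sorted_wrt_mono_rel[rotated]) (use less js(2) in force)
  have last_js: "last js = 1"
  proof -
    have "last js \<in> {1..N}"
      using js(1,2) last_in_set by blast
    moreover have "x (last js) \<le> x 1"
      using js(4) assms(1) by simp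
    ultimately show ?thesis
      using x_less_iff[of 1 "last js"] assms(1) by auto
  qed
  have last_ks: "last ks = N"
  proof -
    have "last ks \<in> {1..N}"
      using ks(1,2) last_in_set by blast
    moreover have "x N \<le> x (last ks)"
      using ks(4) assms(1) by simp
    ultimately show ?thesis
      using x_less_iff[of "last ks" N] assms(1) by auto
  qed
  define L where "L = rev js @ ks"
  have "a \<le> J" if "a \<in> set js" for a
    using that js(1,3) js_sorted by (cases js) (auto simp: sorted_wrt_append intro: less_imp_le)
  moreover have "K \<le> b" if "b \<in> set ks" for b
    using that ks(1,3) ks_sorted by (cases ks) (auto intro: less_imp_le)
  ultimately have L_sorted: "sorted_wrt (<) L"
    using js_sorted ks_sorted JK(3) unfolding L_def sorted_wrt_append by fastforce
  \<comment> \<open>The absolute values in \<open>gam_tilde\<close> are harmless: all kinks beyond \<open>\<gamma>\<close> are positive, so \<open>\<beta>\<close> increases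
    along both chains, that is, away from the dominant pair.\<close>
  have left: "kinks (\<lambda>j. - 2 * x j) \<beta> {1..N} \<inter> {\<gamma><..} =
      (\<lambda>(a, b). gam_tilde x \<beta> a b) ` set (zip (rev js) (tl (rev js)))"
    unfolding set_zip_tl_rev image_image js_kinks
  proof (rule image_cong[OF refl], clarify)
    fix a b assume ab: "(a, b) \<in> set (zip js (tl js))"
    then have "x b < x a"
      using js(5) unfolding set_zip_tl by (auto simp: sorted_wrt_iff_nth_less)
    moreover have "(\<beta> b - \<beta> a) / (- 2 * x b - - 2 * x a) \<in> kinks (\<lambda>k. - 2 * x k) \<beta> {1..N} \<inter> {\<gamma><..}"
      unfolding js_kinks by (rule image_eqI[OF _ ab]) simp
    then have "\<gamma> < (\<beta> b - \<beta> a) / (- 2 * x b - - 2 * x a)"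
      by blast
    then have "0 < (\<beta> b - \<beta> a) / (- 2 * x b - - 2 * x a)"
      using \<gamma>_pos by (rule less_trans[rotated])
    ultimately show "(\<beta> b - \<beta> a) / (- 2 * x b - - 2 * x a) =
        (case prod.swap (a, b) of (a, b) \<Rightarrow> gam_tilde x \<beta> a b)"
      by (simp add: gam_tilde_def zero_less_divide_iff algebra_simps)
  qed
  have right: "kinks (\<lambda>k. 2 * x k) \<beta> {1..N} \<inter> {\<gamma><..} =
      (\<lambda>(a, b). gam_tilde x \<beta> a b) ` set (zip ks (tl ks))"
    unfolding ks_kinks
  proof (rule image_cong[OF refl], clarify)
    fix a b assume ab: "(a, b) \<in> set (zip ks (tl ks))"
    then have "x a < x b"
      using ks(5) unfolding set_zip_tl by (auto simp: sorted_wrt_iff_nth_less)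
    moreover have "(\<beta> b - \<beta> a) / (2 * x b - 2 * x a) \<in> kinks (\<lambda>k. 2 * x k) \<beta> {1..N} \<inter> {\<gamma><..}"
      unfolding ks_kinks by (rule image_eqI[OF _ ab]) simp
    then have "\<gamma> < (\<beta> b - \<beta> a) / (2 * x b - 2 * x a)"
      by blast
    then have "0 < (\<beta> b - \<beta> a) / (2 * x b - 2 * x a)"
      using \<gamma>_pos by (rule less_trans[rotated])
    ultimately show "(\<beta> b - \<beta> a) / (2 * x b - 2 * x a) = gam_tilde x \<beta> a b"
      by (simp add: gam_tilde_def zero_less_divide_iff algebra_simps)
  qed
  let ?n = "length L" and ?j = "\<lambda>i. L ! (i - 1)" and ?I = "length js"
  have len: "?n = length js + length ks" "0 < length js" "0 < length ks"
    using js(1) ks(1) by (auto simp: L_def)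
  have "newton_slopes P = {\<gamma>} \<union> (\<lambda>(a, b). gam_tilde x \<beta> a b) `
      (set (zip (rev js) (tl (rev js))) \<union> set (zip ks (tl ks)))"
    unfolding slopes_eq left right by auto
  also have "set (zip (rev js) (tl (rev js))) \<union> set (zip ks (tl ks)) =
      {(?j i, ?j (i + 1)) | i. i \<in> {1..?n - 1} \<and> i \<noteq> ?I}"
    using set_zip_tl_append[of "rev js" ks] js(1) ks(1) by (simp add: L_def)
  also have "(\<lambda>(a, b). gam_tilde x \<beta> a b) ` \<dots> =
      {gam_tilde x \<beta> (?j i) (?j (i + 1)) | i. i \<in> {1..?n - 1} \<and> i \<noteq> ?I}"
    by auto
  finally have slopes: "newton_slopes P = {\<gamma>} \<union>
      {gam_tilde x \<beta> (?j i) (?j (i + 1)) | i. i \<in> {1..?n - 1} \<and> i \<noteq> ?I}" .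
  have "?j 1 = 1"
    using js(1) last_js by (simp add: L_def nth_append rev_nth last_conv_nth)
  moreover have "?j ?n = N"
    using ks(1) last_ks last_conv_nth[of L] by (simp add: L_def)
  moreover have "strict_mono_on {1..?n} ?j"
    using L_sorted by (auto simp: strict_mono_on_def sorted_wrt_iff_nth_less)
  moreover have "?j ?I = J"
    using js(1,3) by (simp add: L_def nth_append rev_nth hd_conv_nth)
  moreover have "?j (?I + 1) = K"
    using ks(1,3) by (simp add: L_def nth_append hd_conv_nth)
  moreover have "2 \<le> ?n" "1 \<le> ?I" "?I \<le> ?n - 1"
    using len by linarith+
  then have "2 \<le> ?n" "?I \<in> {1..?n - 1}"
    by auto
  ultimately show ?thesis
    using slopes by (intro exI[of _ ?n] exI[of _ ?j] exI[of _ ?I]) simp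
qed

end
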